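(* Let $(X,d)$ be a compact metric space and let $f: X \to X$ be a continuous minimal map. Then either there exists an $f$-invariant ergodic Borel probability measure $\mu$ such that, in the weak$^*$ topology, $$\lim_{n \to +\infty} \frac1n\sum_{j=0}^{n-1} \delta_{f^j(x)} = \mu \qquad \forall\, x \in X,$$ or the set $$\mathfrak I = \Big\{x \in X : \lim_{n \to +\infty} \frac1n\sum_{j=0}^{n-1} \delta_{f^j(x)} \text{ does not exist in the weak}^* \text{ topology}\Big\}$$ is Baire residual in $X$.
   Context: A continuous map $f:X\to X$ is minimal if the forward orbit $\{f^n(x): n\geqslant 0\}$ of every $x\in X$ is dense in $X$. A subset of a topological space is Baire residual if it contains a countable intersection of open dense subsets. $\delta_y$ denotes the Dirac measure at $y$. *)

theory Defs
  imports "HOL-Probability.Probability"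
begin

text \<open>The compact metric space is the universe of a type of class \<^class>\<open>metric_space\<close>;
  compactness of \<^term>\<open>UNIV\<close> is assumed where it is needed.\<close>

definition minimal_map :: "('a::topological_space \<Rightarrow> 'a) \<Rightarrow> bool" where
  "minimal_map f \<longleftrightarrow>
     continuous_on UNIV f \<and> (\<forall>x. closure (range (\<lambda>n. (f ^^ n) x)) = UNIV)"

definition baire_residual :: "'a::topological_space set \<Rightarrow> bool" where
  "baire_residual S \<longleftrightarrow>
     (\<exists>\<U>. countable \<U> \<and> (\<forall>U\<in>\<U>. open U \<and> closure U = UNIV) \<and> \<Inter>\<U> \<subseteq> S)"

definition borel_prob :: "'a::topological_space measure set" where
  "borel_prob = {\<mu>. sets \<mu> = sets borel \<and> prob_space \<mu>}"

definition invariant_measure :: "('a::topological_space \<Rightarrow> 'a) \<Rightarrow> 'a measure \<Rightarrow> bool" where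
  "invariant_measure f \<mu> \<longleftrightarrow> (\<forall>A\<in>sets borel. emeasure \<mu> (f -` A) = emeasure \<mu> A)"

definition ergodic_measure :: "('a::topological_space \<Rightarrow> 'a) \<Rightarrow> 'a measure \<Rightarrow> bool" where
  "ergodic_measure f \<mu> \<longleftrightarrow> invariant_measure f \<mu> \<and>
     (\<forall>A\<in>sets borel. f -` A = A \<longrightarrow> emeasure \<mu> A = 0 \<or> emeasure \<mu> A = 1)"

text \<open>The coarsest topology on the Borel probability measures that makes
  \<open>\<mu> \<mapsto> \<integral>\<phi> d\<mu>\<close> continuous for every continuous real function \<open>\<phi>\<close>. The test functions are
  not required to be bounded, so this is the weak* topology only on a compact space.\<close>
definition weak_star_topology :: "'a::topological_space measure topology" where
  "weak_star_topology =
     pullback_topology borel_prob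
       (\<lambda>\<mu>. \<lambda>\<phi>\<in>{\<phi>. continuous_on UNIV \<phi>}. integral\<^sup>L \<mu> \<phi>)
       (product_topology (\<lambda>_. euclideanreal) {\<phi>. continuous_on UNIV \<phi>})"

text \<open>The measure \<open>(1/n) * (\<delta>\<^sub>x + \<delta>\<^bsub>f x\<^esub> + \<dots>)\<close> with \<open>n\<close> summands. For \<open>n = 0\<close> it is the zero
  measure, which lies outside \<^const>\<open>borel_prob\<close>; this does not affect limits.\<close>
definition empirical_measure :: "('a::topological_space \<Rightarrow> 'a) \<Rightarrow> nat \<Rightarrow> 'a \<Rightarrow> 'a measure" where
  "empirical_measure f n x =
     measure_of UNIV (sets borel)
       (\<lambda>A. ennreal (1 / real n) * (\<Sum>j<n. emeasure (return borel ((f ^^ j) x)) A))"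

definition irregular_set :: "('a::topological_space \<Rightarrow> 'a) \<Rightarrow> 'a set" where
  "irregular_set f =
     {x. \<not> (\<exists>\<nu>. limitin weak_star_topology (\<lambda>n. empirical_measure f n x) \<nu> sequentially)}"

lemma topspace_weak_star [simp]: "topspace weak_star_topology = borel_prob"
  by (auto simp: weak_star_topology_def topspace_pullback_topology)

lemma sets_empirical_measure [measurable_cong, simp]:
  "sets (empirical_measure f n x) = sets borel"
  by (simp add: empirical_measure_def sets_measure_of_conv sets.sigma_sets_eq[of borel, simplified]
        sets.space_closed[of borel, simplified])

lemma space_empirical_measure [simp]: "space (empirical_measure f n x) = UNIV"
  by (simp add: empirical_measure_def space_measure_of_conv)

lemma emeasure_empirical_measure:
  assumes "A \<in> sets borel"
  shows "emeasure (empirical_measure f n x) A =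
    ennreal (1 / real n) * (\<Sum>j<n. indicator A ((f ^^ j) x))"
proof -
  let ?m = "\<lambda>A. ennreal (1 / real n) * (\<Sum>j<n. emeasure (return borel ((f ^^ j) x)) A)"
  have "emeasure (empirical_measure f n x) A = ?m A"
    unfolding empirical_measure_def
  proof (rule emeasure_measure_of_sigma)
    show "sigma_algebra UNIV (sets (borel :: 'a measure))"
      using sets.sigma_algebra_axioms[of "borel :: 'a measure"] by simp
    show "positive (sets borel) ?m"
      by (simp add: positive_def)
    show "countably_additive (sets borel) ?m"
    proof (rule countably_additiveI)
      fix B :: "nat \<Rightarrow> 'a set"
      assume B: "range B \<subseteq> sets borel" "disjoint_family B" "\<Union>(range B) \<in> sets borel"
      have "(\<Sum>i. ?m (B i)) =
          ennreal (1 / real n) * (\<Sum>j<n. \<Sum>i. emeasure (return borel ((f ^^ j) x)) (B i))"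
        by (simp add: suminf_sum[symmetric])
      also have "\<dots> = ?m (\<Union>(range B))"
        using B by (simp add: suminf_emeasure del: emeasure_return)
      finally show "(\<Sum>i. ?m (B i)) = ?m (\<Union>(range B))" .
    qed
  qed (fact assms)
  with assms show ?thesis by simp
qed

lemma empirical_measure_in_borel_prob:
  assumes "n > 0"
  shows "empirical_measure f n x \<in> borel_prob"
proof -
  have "emeasure (empirical_measure f n x) UNIV = ennreal (1 / real n) * ennreal (real n)"
    by (simp add: emeasure_empirical_measure ennreal_of_nat_eq_real_of_nat)
  also have "\<dots> = 1"
    using assms by (simp flip: ennreal_mult)
  finally show ?thesis
    by (auto simp: borel_prob_def intro!: prob_spaceI)
qed

lemma limitin_weak_star:
  "limitin weak_star_topology M \<mu> F \<longleftrightarrow>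
     \<mu> \<in> borel_prob \<and> eventually (\<lambda>n. M n \<in> borel_prob) F \<and>
     (\<forall>\<phi> :: 'a::topological_space \<Rightarrow> real. continuous_on UNIV \<phi> \<longrightarrow>
        ((\<lambda>n. integral\<^sup>L (M n) \<phi>) \<longlongrightarrow> integral\<^sup>L \<mu> \<phi>) F)"
proof -
  define C where "C = {\<phi> :: 'a \<Rightarrow> real. continuous_on UNIV \<phi>}"
  define I where "I = (\<lambda>\<mu> :: 'a measure. \<lambda>\<phi>\<in>C. integral\<^sup>L \<mu> \<phi>)"
  let ?P = "product_topology (\<lambda>_. euclideanreal) C"
  have W: "weak_star_topology = pullback_topology borel_prob I ?P"
    unfolding weak_star_topology_def C_def I_def ..
  have top: "I \<nu> \<in> topspace ?P" for \<nu>
    by (simp add: I_def)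
  have "limitin weak_star_topology M \<mu> F \<longleftrightarrow>
      \<mu> \<in> borel_prob \<and> eventually (\<lambda>n. M n \<in> borel_prob) F \<and> limitin ?P (\<lambda>n. I (M n)) (I \<mu>) F"
    (is "?L \<longleftrightarrow> ?R")
  proof
    assume L: ?L
    then have mu: "\<mu> \<in> borel_prob"
      using limitin_topspace by fastforce
    have ev: "eventually (\<lambda>n. M n \<in> borel_prob) F"
      using L mu unfolding limitin_def by (metis openin_topspace topspace_weak_star)
    have "eventually (\<lambda>n. I (M n) \<in> U) F" if "openin ?P U" "I \<mu> \<in> U" for U
    proof -
      have "openin weak_star_topology (I -` U \<inter> borel_prob)"
        unfolding W openin_pullback_topology using that by blast
      with L mu that have "eventually (\<lambda>n. M n \<in> I -` U \<inter> borel_prob) F"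
        unfolding limitin_def by blast
      then show ?thesis by (rule eventually_mono) auto
    qed
    with mu ev top show ?R unfolding limitin_def by blast
  next
    assume R: ?R
    have "eventually (\<lambda>n. M n \<in> V) F" if V: "openin weak_star_topology V" "\<mu> \<in> V" for V
    proof -
      obtain U where U: "openin ?P U" "V = I -` U \<inter> borel_prob"
        using V unfolding W openin_pullback_topology by blast
      with R V have "eventually (\<lambda>n. I (M n) \<in> U) F"
        unfolding limitin_def by blast
      with R have "eventually (\<lambda>n. I (M n) \<in> U \<and> M n \<in> borel_prob) F"
        by (simp add: eventually_conj)
      then show ?thesis by (rule eventually_mono) (use U in auto)
    qed
    with R show ?L unfolding limitin_def by simp
  qed
  also have "limitin ?P (\<lambda>n. I (M n)) (I \<mu>) F \<longleftrightarrow>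
      (\<forall>\<phi>\<in>C. ((\<lambda>n. integral\<^sup>L (M n) \<phi>) \<longlongrightarrow> integral\<^sup>L \<mu> \<phi>) F)"
    by (simp add: limitin_componentwise I_def cong: ball_cong)
  finally show ?thesis
    by (simp add: C_def)
qed

end

theory Submission
  imports Defs
begin

text \<open>
  Everything is read off from the Birkhoff averages \<open>(1/n) (\<phi> x + \<dots> + \<phi> (f\<^sup>n\<^sup>-\<^sup>1 x))\<close> of
  continuous test functions \<open>\<phi>\<close>, which are the integrals of \<open>\<phi>\<close> against the empirical measures.

  Suppose that for some \<open>\<phi>\<close> there are points \<open>x\<close>, \<open>y\<close> and numbers \<open>b < a\<close> such that the averages
  at \<open>x\<close> exceed \<open>a\<close> infinitely often and those at \<open>y\<close> fall below \<open>b\<close> infinitely often. Both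
  properties pass to the whole orbit of the point, up to an arbitrarily small loss in \<open>a\<close> and \<open>b\<close>,
  and orbits are dense. Hence for every \<open>N\<close> the open set of points whose averages exceed
  (or fall below) the adjusted threshold at some time after \<open>N\<close> is dense. A point in all of
  these sets has oscillating averages, so it is irregular (\<open>residual_divergence\<close>).

  Otherwise every upper limit of averages of \<open>\<phi>\<close> is at most every lower limit, whatever the
  two base points, so the averages converge everywhere to one constant \<open>c \<phi>\<close>
  (\<open>birkhoff_average_common_limit\<close>). The map \<open>c\<close> is a positive normalized linear functional on
  the continuous functions, and the Riesz representation theorem, proved below for compact
  metric spaces, turns it into a Borel probability measure \<open>\<mu>\<close>
  (\<open>integral_representing_measure\<close>). The empirical measures of every point then converge to \<open>\<mu>\<close>.
  Since finite Borel measures are determined by their integrals of continuous functions, \<open>\<mu>\<close> is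
  invariant. If \<open>A\<close> is an invariant set, integrating the averages of \<open>\<phi>\<close> over \<open>A\<close> and letting
  \<open>n\<close> tend to infinity gives \<open>\<integral>\<^sub>A \<phi> d\<mu> = \<mu> A \<cdot> \<integral> \<phi> d\<mu>\<close>, that is, \<open>\<mu>\<close> restricted to \<open>A\<close> is
  \<open>\<mu> A \<cdot> \<mu>\<close>; evaluating both at \<open>A\<close> yields \<open>\<mu> A = (\<mu> A)\<^sup>2\<close>, so \<open>\<mu>\<close> is ergodic.
\<close>

section \<open>Continuous functions and Borel measures\<close>

lemma bounded_continuous_compact:
  fixes \<phi> :: "'a::topological_space \<Rightarrow> real"
  assumes "compact (UNIV :: 'a set)" "continuous_on UNIV \<phi>"
  obtains B where "\<forall>x. \<bar>\<phi> x\<bar> \<le> B"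
  using compact_imp_bounded[OF compact_continuous_image[OF assms(2,1)]]
  unfolding bounded_iff real_norm_def by blast

lemma integrable_continuous_compact:
  fixes \<phi> :: "'a::topological_space \<Rightarrow> real"
  assumes "compact (UNIV :: 'a set)" "finite_measure M" "sets M = sets borel"
    and \<phi>: "continuous_on UNIV \<phi>"
  shows "integrable M \<phi>"
proof -
  obtain B where "\<forall>x. \<bar>\<phi> x\<bar> \<le> B"
    using bounded_continuous_compact[OF assms(1) \<phi>] by blast
  moreover have "\<phi> \<in> borel_measurable M"
    using borel_measurable_continuous_onI[OF \<phi>] assms(3) by (simp cong: measurable_cong_sets)
  ultimately show ?thesis
    using assms(2) by (intro finite_measure.integrable_const_bound[of _ _ B]) auto
qed

text \<open>Continuous functions increasing with \<open>k\<close> to the indicator function of the open set \<open>U\<close>. The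
  whole space is treated apart because \<^const>\<open>infdist\<close> to the empty set is \<open>0\<close>.\<close>

definition bump :: "'a::metric_space set \<Rightarrow> nat \<Rightarrow> 'a \<Rightarrow> real" where
  "bump U k x = (if U = UNIV then 1 else min 1 (real k * infdist x (- U)))"

lemma continuous_on_bump: "continuous_on UNIV (bump U k)"
proof (cases "U = UNIV")
  case True
  then show ?thesis by (simp add: bump_def)
next
  case False
  then have "bump U k = (\<lambda>x. min 1 (real k * infdist x (- U)))"
    by (simp add: bump_def fun_eq_iff)
  then show ?thesis by (auto intro!: continuous_intros)
qed

lemma bump_bounds: "0 \<le> bump U k x" "bump U k x \<le> 1"
  by (auto simp: bump_def infdist_nonneg)

lemma bump_le_indicator: "bump U k x \<le> indicator U x"
  by (auto simp: bump_def indicator_def)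

lemma bump_mono: "m \<le> n \<Longrightarrow> bump U m x \<le> bump U n x"
  by (simp add: bump_def min.coboundedI2 mult_right_mono infdist_nonneg)

lemma eventually_bump_eq_1:
  assumes "open U" "x \<in> U"
  shows "eventually (\<lambda>k. bump U k x = 1) sequentially"
proof (cases "U = UNIV")
  case True
  then show ?thesis by (simp add: bump_def)
next
  case False
  with assms have pos: "infdist x (- U) > 0"
    by (intro infdist_pos_not_in_closed) auto
  have "eventually (\<lambda>k. real k \<ge> 1 / infdist x (- U)) sequentially"
    using filterlim_real_sequentially by (simp add: filterlim_at_top)
  then show ?thesis
    by eventually_elim (use pos False in \<open>auto simp: bump_def field_simps\<close>)
qed

lemma bump_tendsto_indicator:
  assumes "open U"
  shows "(\<lambda>k. bump U k x) \<longlonglongrightarrow> indicator U x"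
proof (cases "x \<in> U")
  case True
  then show ?thesis
    using eventually_bump_eq_1[OF assms True] by (auto intro: tendsto_eventually)
next
  case False
  then have "bump U k x = 0" for k
    using bump_le_indicator[of U k x] bump_bounds[of U k x] by auto
  then show ?thesis using False by simp
qed

lemma integral_bump_tendsto_measure:
  assumes "finite_measure M" "sets M = sets borel" "open U"
  shows "(\<lambda>k. integral\<^sup>L M (bump U k)) \<longlonglongrightarrow> measure M U"
proof -
  interpret finite_measure M by fact
  have meas: "borel_measurable M = borel_measurable borel"
    by (rule measurable_cong_sets) (simp_all add: assms)
  have "(\<lambda>k. integral\<^sup>L M (bump U k)) \<longlonglongrightarrow> integral\<^sup>L M (indicator U)"
  proof (rule integral_dominated_convergence[where w = "\<lambda>_. 1"])
    show "(indicator U :: _ \<Rightarrow> real) \<in> borel_measurable M"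
      using assms by (simp add: meas)
    show "bump U k \<in> borel_measurable M" for k
      unfolding meas by (intro borel_measurable_continuous_onI continuous_on_bump)
    show "AE x in M. (\<lambda>k. bump U k x) \<longlonglongrightarrow> indicator U x"
      by (simp add: bump_tendsto_indicator assms)
    show "AE x in M. norm (bump U k x) \<le> 1" for k
      by (simp add: bump_bounds)
  qed simp
  then show ?thesis using assms by simp
qed

text \<open>The measure of an open set is the limit of the integrals of its bump functions, and the open
  sets are an intersection-stable generator of the Borel sets.\<close>

lemma finite_measure_eqI_continuous:
  fixes M N :: "'a::metric_space measure"
  assumes "finite_measure M" "finite_measure N"
    and sets: "sets M = sets borel" "sets N = sets borel"
    and eq: "\<And>\<phi> :: 'a \<Rightarrow> real. continuous_on UNIV \<phi> \<Longrightarrow> integral\<^sup>L M \<phi> = integral\<^sup>L N \<phi>"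
  shows "M = N"
proof -
  interpret M: finite_measure M by fact
  interpret N: finite_measure N by fact
  have "emeasure M U = emeasure N U" if "open U" for U
  proof -
    have "(\<lambda>k. integral\<^sup>L M (bump U k)) \<longlonglongrightarrow> measure N U"
      using integral_bump_tendsto_measure[OF \<open>finite_measure N\<close> sets(2) that]
      by (simp add: eq continuous_on_bump)
    then have "measure M U = measure N U"
      using integral_bump_tendsto_measure[OF \<open>finite_measure M\<close> sets(1) that]
      by (blast intro: LIMSEQ_unique)
    then show ?thesis
      by (simp add: M.emeasure_eq_measure N.emeasure_eq_measure)
  qed
  then show ?thesis
    by (intro measure_eqI_generator_eq[where E = "{U. open U}" and \<Omega> = UNIV and A = "\<lambda>_. UNIV"])
      (auto simp: Int_stable_def sets borel_def)
qed

section \<open>The Riesz representation theorem on a compact metric space\<close>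

text \<open>The functional \<open>c\<close> is defined on all functions, but only its values on continuous functions
  are constrained.\<close>

locale positive_normalized_functional =
  fixes c :: "('a::metric_space \<Rightarrow> real) \<Rightarrow> real"
  assumes compact_space: "compact (UNIV :: 'a set)"
    and add: "\<And>\<phi> \<psi>. continuous_on UNIV \<phi> \<Longrightarrow> continuous_on UNIV \<psi> \<Longrightarrow>
      c (\<lambda>x. \<phi> x + \<psi> x) = c \<phi> + c \<psi>"
    and scale: "\<And>\<phi> r. continuous_on UNIV \<phi> \<Longrightarrow> c (\<lambda>x. r * \<phi> x) = r * c \<phi>"
    and mono: "\<And>\<phi> \<psi>. continuous_on UNIV \<phi> \<Longrightarrow> continuous_on UNIV \<psi> \<Longrightarrow>
      (\<And>x. \<phi> x \<le> \<psi> x) \<Longrightarrow> c \<phi> \<le> c \<psi>"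
    and one: "c (\<lambda>_. 1) = 1"
begin

lemma const: "c (\<lambda>_. r) = r"
  using scale[of "\<lambda>_. 1" r] one by simp

lemma nonneg: "continuous_on UNIV \<phi> \<Longrightarrow> (\<And>x. 0 \<le> \<phi> x) \<Longrightarrow> 0 \<le> c \<phi>"
  using mono[of "\<lambda>_. 0" \<phi>] by (simp add: const)

lemma sum:
  assumes "\<And>i. i \<in> I \<Longrightarrow> continuous_on UNIV (g i)"
  shows "c (\<lambda>x. \<Sum>i\<in>I. g i x) = (\<Sum>i\<in>I. c (g i))"
  using assms
  by (induction I rule: infinite_finite_induct) (auto simp: const add continuous_on_sum)

definition subordinate :: "'a set \<Rightarrow> ('a \<Rightarrow> real) set" where
  "subordinate U = {\<phi>. continuous_on UNIV \<phi> \<and> (\<forall>x. 0 \<le> \<phi> x \<and> \<phi> x \<le> indicator U x)}"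

text \<open>The value that a representing measure has to take on an open set \<open>U\<close>: the indicator function
  of \<open>U\<close> is approximated from below by continuous functions. In a metric space the support of
  these functions may touch the boundary of \<open>U\<close>, as long as they vanish outside \<open>U\<close>.\<close>

definition content :: "'a set \<Rightarrow> ennreal" where
  "content U = (SUP \<phi>\<in>subordinate U. ennreal (c \<phi>))"

definition outer :: "'a set \<Rightarrow> ennreal" where
  "outer A = (INF U\<in>{U. open U \<and> A \<subseteq> U}. content U)"

lemma bump_subordinate: "bump U k \<in> subordinate U"
  by (simp add: subordinate_def continuous_on_bump bump_bounds bump_le_indicator)

lemma subordinate_le_content: "\<phi> \<in> subordinate U \<Longrightarrow> ennreal (c \<phi>) \<le> content U"
  unfolding content_def by (rule SUP_upper)

lemma content_mono: "U \<subseteq> V \<Longrightarrow> content U \<le> content V"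
proof -
  assume "U \<subseteq> V"
  then have "indicator U x \<le> (indicator V x :: real)" for x
    by (auto simp: indicator_def)
  then have "subordinate U \<subseteq> subordinate V"
    unfolding subordinate_def by (blast intro: order_trans)
  then show ?thesis
    unfolding content_def by (intro SUP_subset_mono) auto
qed

lemma subordinate_empty: "\<phi> \<in> subordinate {} \<Longrightarrow> \<phi> = (\<lambda>_. 0)"
  by (auto simp: subordinate_def fun_eq_iff intro: antisym)

lemma content_empty: "content {} = 0"
proof -
  have "content {} \<le> 0"
    unfolding content_def by (intro SUP_least) (auto dest: subordinate_empty simp: const)
  then show ?thesis by simp
qed

lemma content_UNIV: "content UNIV = 1"
proof (rule antisym)
  show "content UNIV \<le> 1"
    unfolding content_def
  proof (rule SUP_least)
    fix \<phi> :: "'a \<Rightarrow> real" assume "\<phi> \<in> subordinate UNIV"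
    then have "c \<phi> \<le> 1"
      using mono[of \<phi> "\<lambda>_. 1"] by (simp add: subordinate_def one)
    then show "ennreal (c \<phi>) \<le> 1" by (simp add: ennreal_le_1)
  qed
  have "ennreal (c (\<lambda>_. 1)) \<le> content UNIV"
    by (rule subordinate_le_content) (simp add: subordinate_def)
  then show "1 \<le> content UNIV" by (simp add: one)
qed

lemma outer_le_content: "open U \<Longrightarrow> A \<subseteq> U \<Longrightarrow> outer A \<le> content U"
  unfolding outer_def by (rule INF_lower) simp

lemma outer_open: "open U \<Longrightarrow> outer U = content U"
  unfolding outer_def
  by (intro antisym INF_greatest INF_lower) (auto intro: content_mono)

lemma outer_mono: "A \<subseteq> B \<Longrightarrow> outer A \<le> outer B"
  unfolding outer_def by (rule INF_superset_mono) auto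

text \<open>A Dini argument. If \<open>\<phi>\<close> lies below the indicator function of \<open>\<Union>i. U i\<close>, then the functions
  \<open>\<Sum>i<n. bump (U i) n\<close> increase with \<open>n\<close> and eventually exceed \<open>\<phi> - e\<close> at each point, hence by
  compactness at all points for one common \<open>n\<close>.\<close>

lemma content_countably_subadditive:
  fixes U :: "nat \<Rightarrow> 'a set"
  assumes U: "\<And>i. open (U i)"
  shows "content (\<Union>i. U i) \<le> (\<Sum>i. content (U i))"
  unfolding content_def[of "\<Union>i. U i"]
proof (rule SUP_least, rule ennreal_le_epsilon)
  fix \<phi> and e :: real
  assume \<phi>: "\<phi> \<in> subordinate (\<Union>i. U i)" and e: "0 < e"
  then have cont: "continuous_on UNIV \<phi>" by (simp add: subordinate_def)
  define s where "s n x = (\<Sum>i<n. bump (U i) n x)" for n x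
  have s_cont: "continuous_on UNIV (s n)" for n
    unfolding s_def by (intro continuous_intros continuous_on_bump)
  have s_mono: "s m x \<le> s n x" if "m \<le> n" for m n x
  proof -
    have "s m x \<le> (\<Sum>i<m. bump (U i) n x)"
      unfolding s_def by (intro sum_mono bump_mono that)
    also have "\<dots> \<le> s n x"
      unfolding s_def using that by (intro sum_mono2) (auto simp: bump_bounds)
    finally show ?thesis .
  qed
  have "\<exists>n. \<phi> x < e + s n x" for x
  proof (cases "x \<in> (\<Union>i. U i)")
    case True
    then obtain i where i: "x \<in> U i" by blast
    have "eventually (\<lambda>k. bump (U i) k x = 1 \<and> i < k) sequentially"
      using eventually_bump_eq_1[OF U i] eventually_gt_at_top[of i] by eventually_elim simp
    then obtain k where k: "bump (U i) k x = 1" "i < k"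
      by (auto simp: eventually_sequentially)
    then have "bump (U i) k x \<le> s k x"
      unfolding s_def by (intro member_le_sum) (auto simp: bump_bounds)
    moreover have "\<phi> x \<le> 1"
      using \<phi> by (auto simp: subordinate_def indicator_def intro: order_trans split: if_splits)
    ultimately show ?thesis using k e by (intro exI[of _ k]) linarith
  next
    case False
    then have "\<phi> x \<le> 0" using \<phi> unfolding subordinate_def by (auto dest!: spec[of _ x])
    then show ?thesis using e by (intro exI[of _ 0]) (simp add: s_def)
  qed
  then have cover: "UNIV \<subseteq> (\<Union>n\<in>UNIV. {x. \<phi> x < e + s n x})" by auto
  have op: "open {x. \<phi> x < e + s n x}" for n
    by (intro open_Collect_less continuous_intros cont s_cont)
  obtain D where D: "finite D" "UNIV \<subseteq> (\<Union>n\<in>D. {x. \<phi> x < e + s n x})"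
    by (rule compactE_image[OF compact_space _ cover]) (use op in auto)
  then obtain n where n: "\<And>i. i \<in> D \<Longrightarrow> i \<le> n"
    by (metis finite_nat_set_iff_bounded_le)
  have "\<phi> x \<le> e + s n x" for x
  proof -
    obtain m where "m \<in> D" "\<phi> x < e + s m x" using D by blast
    with s_mono[OF n, of m x] show ?thesis by simp
  qed
  then have "c \<phi> \<le> c (\<lambda>x. e + s n x)"
    by (intro mono cont continuous_intros s_cont)
  also have "\<dots> = e + c (s n)"
    using s_cont[of n] by (simp add: add const)
  also have "c (s n) = (\<Sum>i<n. c (bump (U i) n))"
    unfolding s_def by (rule sum) (rule continuous_on_bump)
  finally have "ennreal (c \<phi>) \<le> ennreal ((\<Sum>i<n. c (bump (U i) n)) + e)"
    by (intro ennreal_leI) simp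
  also have "\<dots> = (\<Sum>i<n. ennreal (c (bump (U i) n))) + ennreal e"
    using e by (simp add: nonneg continuous_on_bump bump_bounds sum_nonneg sum_ennreal)
  also have "(\<Sum>i<n. ennreal (c (bump (U i) n))) \<le> (\<Sum>i<n. content (U i))"
    by (intro sum_mono subordinate_le_content bump_subordinate)
  also have "\<dots> \<le> (\<Sum>i. content (U i))"
    by (intro sum_le_suminf) auto
  finally show "ennreal (c \<phi>) \<le> (\<Sum>i. content (U i)) + ennreal e"
    by (simp add: add_right_mono)
qed

text \<open>As usual, \<open>A i\<close> is covered by an open set whose content exceeds its outer measure by less than
  \<open>e / 2\<^sup>i\<^sup>+\<^sup>1\<close>.\<close>

lemma outer_countably_subadditive:
  fixes A :: "nat \<Rightarrow> 'a set"
  shows "outer (\<Union>i. A i) \<le> (\<Sum>i. outer (A i))"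
proof (rule ennreal_le_epsilon)
  fix e :: real assume e: "0 < e" and fin: "(\<Sum>i. outer (A i)) < top"
  have "outer (A i) < outer (A i) + e * (1/2)^Suc i" for i
    using e fin by (auto simp: less_top dest!: ennreal_suminf_lessD)
  then have "\<exists>U. open U \<and> A i \<subseteq> U \<and> content U < outer (A i) + e * (1/2)^Suc i" for i
    using INF_less_iff[of content "{U. open U \<and> A i \<subseteq> U}" "outer (A i) + e * (1/2)^Suc i"]
    unfolding outer_def[symmetric] by blast
  then obtain U where U: "\<And>i. open (U i)" "\<And>i. A i \<subseteq> U i"
    "\<And>i. content (U i) < outer (A i) + e * (1/2)^Suc i"
    by metis
  have "outer (\<Union>i. A i) \<le> content (\<Union>i. U i)"
    using U by (intro outer_le_content) auto
  also have "\<dots> \<le> (\<Sum>i. content (U i))"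
    by (rule content_countably_subadditive) (rule U)
  also have "\<dots> \<le> (\<Sum>i. outer (A i) + e * (1/2)^Suc i)"
    using U(3) by (intro suminf_le allI less_imp_le) auto
  also have "\<dots> = (\<Sum>i. outer (A i)) + (\<Sum>i. ennreal e * ennreal ((1/2) ^ Suc i))"
    using e by (subst suminf_add[symmetric])
      (auto simp del: ennreal_suminf_cmult simp add: ennreal_mult[symmetric])
  also have "\<dots> = (\<Sum>i. outer (A i)) + e"
    unfolding ennreal_suminf_cmult
    by (subst suminf_ennreal_eq[OF zero_le_power power_half_series]) auto
  finally show "outer (\<Union>i. A i) \<le> (\<Sum>i. outer (A i)) + ennreal e" .
qed

lemma outer_measure_space_outer: "outer_measure_space (Pow UNIV) outer"
  unfolding outer_measure_space_def positive_def increasing_def countably_subadditive_def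
  by (auto intro: outer_mono outer_countably_subadditive simp: outer_open content_empty)

text \<open>This is the Caratheodory inequality for the open set \<open>U\<close>, tested on open sets \<open>V\<close>. Given \<open>\<phi>\<close>
  below the indicator function of \<open>V \<inter> U\<close>, the part of \<open>V\<close> where \<open>\<phi> < e\<close> is an open
  neighbourhood \<open>W\<close> of \<open>V - U\<close>. If \<open>\<psi>\<close> lies below the indicator function of \<open>W\<close>, then
  \<open>max 0 (\<phi> - e)\<close> and \<open>\<psi>\<close> are nonzero on disjoint subsets of \<open>V\<close>, so their sum still lies below
  the indicator function of \<open>V\<close>; the truncation costs only \<open>e\<close>.\<close>

lemma content_split:
  assumes U: "open U" and V: "open V"
  shows "content (V \<inter> U) + outer (V - U) \<le> content V"
proof -
  have "ennreal (c \<phi>) + outer (V - U) \<le> content V" if \<phi>: "\<phi> \<in> subordinate (V \<inter> U)" for \<phi>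
  proof (rule ennreal_le_epsilon)
    fix e :: real assume e: "0 < e"
    from \<phi> have cont: "continuous_on UNIV \<phi>" by (simp add: subordinate_def)
    define W where "W = V \<inter> {x. \<phi> x < e}"
    have "open W"
      unfolding W_def by (intro open_Int V open_Collect_less cont continuous_intros)
    moreover have "V - U \<subseteq> W"
    proof
      fix x assume x: "x \<in> V - U"
      then have "\<phi> x \<le> 0"
        using \<phi> unfolding subordinate_def by (auto dest!: spec[of _ x])
      with x e show "x \<in> W" by (simp add: W_def)
    qed
    ultimately have "outer (V - U) \<le> content W" by (rule outer_le_content)
    moreover have "ennreal (c \<phi>) + content W \<le> content V + ennreal e"
    proof -
      have "ennreal (c \<phi>) + ennreal (c \<psi>) \<le> content V + ennreal e"
        if \<psi>: "\<psi> \<in> subordinate W" for \<psi>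
      proof -
        from \<psi> have cont': "continuous_on UNIV \<psi>" by (simp add: subordinate_def)
        define \<theta> where "\<theta> x = max 0 (\<phi> x - e) + \<psi> x" for x
        have \<theta>_cont: "continuous_on UNIV \<theta>"
          unfolding \<theta>_def by (intro continuous_intros cont cont')
        have "\<theta> x \<le> indicator V x" "0 \<le> \<theta> x" for x
        proof -
          have "\<phi> x \<le> indicator (V \<inter> U) x" "0 \<le> \<phi> x" "0 \<le> \<psi> x" "\<psi> x \<le> indicator W x"
            using \<phi> \<psi> by (auto simp: subordinate_def)
          then show "\<theta> x \<le> indicator V x" "0 \<le> \<theta> x"
            using e by (cases "x \<in> V"; cases "x \<in> U"; cases "\<phi> x < e"; simp add: \<theta>_def W_def)+
        qed
        then have \<theta>: "\<theta> \<in> subordinate V"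
          using \<theta>_cont by (simp add: subordinate_def)
        have "c \<phi> + c \<psi> = c (\<lambda>x. \<phi> x + \<psi> x)"
          using cont cont' by (simp add: add)
        also have "\<dots> \<le> c (\<lambda>x. \<theta> x + e)"
          by (intro mono continuous_intros cont cont' \<theta>_cont) (simp add: \<theta>_def)
        also have "\<dots> = c \<theta> + e"
          using \<theta>_cont by (simp add: add const)
        finally have "ennreal (c \<phi> + c \<psi>) \<le> ennreal (c \<theta> + e)" by (rule ennreal_leI)
        moreover have "0 \<le> c \<phi>" "0 \<le> c \<psi>" "0 \<le> c \<theta>"
          using \<phi> \<psi> \<theta> by (auto simp: subordinate_def intro!: nonneg)
        ultimately have "ennreal (c \<phi>) + ennreal (c \<psi>) \<le> ennreal (c \<theta>) + ennreal e"
          using e by simp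
        also have "\<dots> \<le> content V + ennreal e"
          using \<theta> by (intro add_right_mono subordinate_le_content)
        finally show ?thesis .
      qed
      moreover have "subordinate W \<noteq> {}" using bump_subordinate by blast
      ultimately show ?thesis
        unfolding content_def[of W] by (subst ennreal_SUP_add_right) (auto intro: SUP_least)
    qed
    ultimately show "ennreal (c \<phi>) + outer (V - U) \<le> content V + ennreal e"
      by (meson add_left_mono order_trans)
  qed
  moreover have "subordinate (V \<inter> U) \<noteq> {}" using bump_subordinate by blast
  ultimately show ?thesis
    unfolding content_def[of "V \<inter> U"]
    by (subst ennreal_SUP_add_left[symmetric]) (auto intro: SUP_least)
qed

text \<open>The measurable sets in the sense of Caratheodory form a sigma-algebra, so it is enough to show
  that open sets are measurable. The inequality for open test sets extends to all test sets,
  because the outer measure is an infimum over open supersets.\<close>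

lemma borel_subset_lambda_system: "sets borel \<subseteq> lambda_system UNIV (Pow UNIV) outer"
proof -
  have "U \<in> lambda_system UNIV (Pow UNIV) outer" if U: "open U" for U
  proof -
    have "outer (A \<inter> U) + outer (A - U) = outer A" for A
    proof (rule antisym)
      show "outer (A \<inter> U) + outer (A - U) \<le> outer A"
        unfolding outer_def[of A]
      proof (rule INF_greatest)
        fix V assume "V \<in> {V. open V \<and> A \<subseteq> V}"
        then have V: "open V" "A \<subseteq> V" by auto
        have "outer (A \<inter> U) + outer (A - U) \<le> content (V \<inter> U) + outer (V - U)"
          using U V by (intro add_mono outer_le_content outer_mono) auto
        also have "\<dots> \<le> content V" by (rule content_split) (fact U V)+
        finally show "outer (A \<inter> U) + outer (A - U) \<le> content V" .
      qed
      \<comment> \<open>finite subadditivity, from the countable one with empty sets\<close>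
      have "outer A = outer (\<Union>i. (\<lambda>i::nat. if i = 0 then A \<inter> U else if i = 1 then A - U else {}) i)"
        by (rule arg_cong[where f = outer]) (auto split: if_splits)
      also have "\<dots> \<le> (\<Sum>i. outer (if i = (0::nat) then A \<inter> U else if i = 1 then A - U else {}))"
        by (rule outer_countably_subadditive)
      also have "\<dots> = (\<Sum>i<2. outer (if i = (0::nat) then A \<inter> U else if i = 1 then A - U else {}))"
        by (rule suminf_finite) (auto simp: outer_open content_empty)
      also have "\<dots> = outer (A \<inter> U) + outer (A - U)"
        by (simp add: numeral_2_eq_2)
      finally show "outer A \<le> outer (A \<inter> U) + outer (A - U)" .
    qed
    then show ?thesis
      by (simp add: lambda_system_def Int_commute Diff_eq)
  qed
  moreover have "sigma_algebra UNIV (lambda_system UNIV (Pow UNIV) outer)"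
    using sigma_algebra.caratheodory_lemma[OF sigma_algebra_Pow outer_measure_space_outer]
    by (simp add: measure_space_def)
  ultimately show ?thesis
    unfolding borel_def
    using sigma_algebra.sigma_sets_subset[of UNIV "lambda_system UNIV (Pow UNIV) outer" "Collect open"]
    by (simp add: subset_eq)
qed

definition representing_measure :: "'a measure" where
  "representing_measure = measure_of UNIV (sets borel) outer"

lemma sets_representing_measure [simp]: "sets representing_measure = sets borel"
  by (metis representing_measure_def sets.sets_measure_of_eq space_borel)

lemma emeasure_representing_measure:
  assumes "A \<in> sets borel"
  shows "emeasure representing_measure A = outer A"
  unfolding representing_measure_def
proof (rule emeasure_measure_of_sigma)
  have "measure_space UNIV (lambda_system UNIV (Pow UNIV) outer) outer"
    by (rule sigma_algebra.caratheodory_lemma[OF sigma_algebra_Pow outer_measure_space_outer])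
  then show "positive (sets borel) outer" "countably_additive (sets borel) outer"
    using borel_subset_lambda_system
    by (auto simp: measure_space_def positive_def countably_additive_def)
  show "sigma_algebra UNIV (sets (borel :: 'a measure))"
    using sets.sigma_algebra_axioms[of "borel :: 'a measure"] by simp
qed fact

lemma space_representing_measure [simp]: "space representing_measure = UNIV"
  by (simp add: representing_measure_def space_measure_of_conv)

sublocale representing: prob_space representing_measure
  by (rule prob_spaceI) (simp add: emeasure_representing_measure outer_open content_UNIV)

lemma integrable_continuous:
  "continuous_on UNIV \<phi> \<Longrightarrow> integrable representing_measure (\<phi> :: 'a \<Rightarrow> real)"
  by (rule integrable_continuous_compact)
    (simp_all add: compact_space representing.finite_measure_axioms)

text \<open>Cut \<open>N \<phi>\<close> into \<open>N\<close> layers \<open>g 0, \<dots>, g (N - 1)\<close> with values between \<open>0\<close> and \<open>1\<close>. Each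
  superlevel set \<open>{i + 1 < N \<phi>}\<close> separates two consecutive layers: its indicator function lies
  above \<open>g (i + 1)\<close>, which bounds the functional by the measure of the set, and below \<open>g i\<close>,
  which bounds that measure by an integral. Shifting the index by one costs the bottom layer,
  that is at most \<open>1 / N\<close> after division by \<open>N\<close>.\<close>

lemma le_integral_unit:
  assumes cont: "continuous_on UNIV \<phi>" and bd: "\<And>x. 0 \<le> \<phi> x" "\<And>x. \<phi> x \<le> 1"
  shows "c \<phi> \<le> integral\<^sup>L representing_measure \<phi>"
proof (rule field_le_epsilon)
  fix e :: real assume "0 < e"
  then obtain n where n: "inverse (real (Suc n)) < e"
    using reals_Archimedean by blast
  define N where "N = Suc n"
  define g where "g i x = max 0 (min 1 (real N * \<phi> x - real i))" for i x
  have N: "0 < real N" by (simp add: N_def)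
  have g_cont: "continuous_on UNIV (g i)" for i
    unfolding g_def by (intro continuous_intros cont)
  have g_bd: "0 \<le> g i x" "g i x \<le> 1" for i x by (auto simp: g_def)
  have slices: "(\<Sum>i<m. max 0 (min 1 (t - real i))) = min t (real m)" if "0 \<le> t" for t m
    using that by (induction m) auto
  have \<phi>_eq: "real N * \<phi> x = (\<Sum>i<N. g i x)" for x
    using slices[of "real N * \<phi> x" N] bd[of x] N by (simp add: g_def mult_left_le)
  have step: "c (g (Suc i)) \<le> integral\<^sup>L representing_measure (g i)" for i
  proof -
    let ?U = "{x. real N * \<phi> x > real (Suc i)}"
    have op: "open ?U" by (intro open_Collect_less continuous_intros cont)
    have "g (Suc i) \<in> subordinate ?U"
      using g_cont[of "Suc i"] by (auto simp: subordinate_def g_def indicator_def)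
    then have "ennreal (c (g (Suc i))) \<le> emeasure representing_measure ?U"
      using op by (simp add: emeasure_representing_measure outer_open subordinate_le_content)
    then have "c (g (Suc i)) \<le> measure representing_measure ?U"
      by (simp add: representing.emeasure_eq_measure)
    also have "\<dots> = integral\<^sup>L representing_measure (indicator ?U)"
      using op by simp
    also have "\<dots> \<le> integral\<^sup>L representing_measure (g i)"
    proof (rule integral_mono)
      show "integrable representing_measure (indicator ?U :: _ \<Rightarrow> real)"
        using op by (simp add: integrable_indicator_iff representing.emeasure_eq_measure)
      show "indicator ?U x \<le> g i x" for x
        by (auto simp: g_def indicator_def)
    qed (rule integrable_continuous[OF g_cont])
    finally show ?thesis .
  qed
  have "real N * c \<phi> = (\<Sum>i<N. c (g i))"
    using cont g_cont by (simp add: scale[symmetric] \<phi>_eq sum)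
  also have "\<dots> = c (g 0) + (\<Sum>i<n. c (g (Suc i)))"
    by (simp only: N_def sum.lessThan_Suc_shift)
  also have "\<dots> \<le> 1 + (\<Sum>i<n. integral\<^sup>L representing_measure (g i))"
    using mono[OF g_cont[of 0], of "\<lambda>_. 1"] g_bd
    by (intro add_mono sum_mono step) (auto simp: one)
  also have "\<dots> \<le> 1 + (\<Sum>i<N. integral\<^sup>L representing_measure (g i))"
    by (simp add: N_def g_bd)
  also have "\<dots> = 1 + integral\<^sup>L representing_measure (\<lambda>x. \<Sum>i<N. g i x)"
    by (simp add: integrable_continuous g_cont)
  also have "\<dots> = 1 + real N * integral\<^sup>L representing_measure \<phi>"
    by (simp add: \<phi>_eq[symmetric])
  finally have "c \<phi> \<le> inverse (real N) + integral\<^sup>L representing_measure \<phi>"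
    using N by (simp add: field_simps)
  then show "c \<phi> \<le> integral\<^sup>L representing_measure \<phi> + e"
    using n by (simp add: N_def)
qed

text \<open>An affine change of scale maps the values of \<open>\<phi>\<close> into the unit interval.\<close>

lemma le_integral:
  assumes cont: "continuous_on UNIV \<phi>"
  shows "c \<phi> \<le> integral\<^sup>L representing_measure \<phi>"
proof -
  obtain B where B: "\<forall>x. \<bar>\<phi> x\<bar> \<le> B"
    using bounded_continuous_compact[OF compact_space cont] by blast
  then have "0 \<le> B" using abs_ge_zero order_trans by blast
  \<comment> \<open>adding 1 makes the divisor positive even if \<open>\<phi>\<close> is zero\<close>
  define K where "K = B + 1"
  have K: "0 < K" using \<open>0 \<le> B\<close> by (simp add: K_def)
  define \<psi> where "\<psi> x = 1/2 + (1 / (2 * K)) * \<phi> x" for x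
  have \<psi>_cont: "continuous_on UNIV \<psi>"
    unfolding \<psi>_def by (intro continuous_intros cont)
  have c\<psi>: "c \<psi> = 1/2 + (1 / (2 * K)) * c \<phi>"
    unfolding \<psi>_def
    by (subst add) (auto simp: const scale[OF cont] simp del: times_divide_eq_left
        intro!: continuous_intros cont)
  have i\<psi>: "integral\<^sup>L representing_measure \<psi> =
      1/2 + (1 / (2 * K)) * integral\<^sup>L representing_measure \<phi>"
    unfolding \<psi>_def using integrable_continuous[OF cont]
    by (simp add: representing.prob_space[simplified])
  have \<phi>_bounds: "- K \<le> \<phi> x" "\<phi> x \<le> K" for x
    using spec[OF B, of x] by (auto simp: K_def abs_le_iff)
  have "0 \<le> \<psi> x" "\<psi> x \<le> 1" for x
    using K \<phi>_bounds[of x] by (auto simp: \<psi>_def field_simps)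
  from le_integral_unit[OF \<psi>_cont this] show ?thesis
    unfolding c\<psi> i\<psi> using K by (simp add: field_simps)
qed

text \<open>The one-sided estimate for both \<open>\<phi>\<close> and \<open>- \<phi>\<close> is an equality.\<close>

theorem integral_representing_measure:
  assumes cont: "continuous_on UNIV \<phi>"
  shows "integral\<^sup>L representing_measure \<phi> = c \<phi>"
proof (rule antisym)
  have "c (\<lambda>x. - \<phi> x) = - c \<phi>"
    using scale[OF cont, of "-1"] by simp
  then show "integral\<^sup>L representing_measure \<phi> \<le> c \<phi>"
    using le_integral[of "\<lambda>x. - \<phi> x"] cont by (simp add: continuous_on_minus)
qed (rule le_integral[OF cont])

lemma representing_measure_in_borel_prob: "representing_measure \<in> borel_prob"
  by (simp add: borel_prob_def representing.prob_space_axioms)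

end

section \<open>Birkhoff averages\<close>

definition birkhoff_average :: "('a \<Rightarrow> 'a) \<Rightarrow> ('a \<Rightarrow> real) \<Rightarrow> nat \<Rightarrow> 'a \<Rightarrow> real" where
  "birkhoff_average f \<phi> n x = (\<Sum>j<n. \<phi> ((f ^^ j) x)) / real n"

lemma continuous_on_funpow:
  fixes f :: "'a::topological_space \<Rightarrow> 'a"
  assumes "continuous_on UNIV f"
  shows "continuous_on UNIV (f ^^ n)"
proof (induction n)
  case (Suc n)
  then show ?case
    using continuous_on_compose[OF Suc, of f] continuous_on_subset[OF assms] by simp
qed (simp add: id_def)

lemma continuous_on_birkhoff_average:
  fixes f :: "'a::topological_space \<Rightarrow> 'a"
  assumes "continuous_on UNIV f" "continuous_on UNIV \<phi>"
  shows "continuous_on UNIV (birkhoff_average f \<phi> n)"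
proof -
  have "continuous_on UNIV (\<lambda>x. \<phi> ((f ^^ j) x))" for j
    by (rule continuous_on_compose2[OF assms(2) continuous_on_funpow[OF assms(1)]]) simp
  moreover have "birkhoff_average f \<phi> n = (\<lambda>x. (\<Sum>j<n. \<phi> ((f ^^ j) x)) * (1 / real n))"
    by (simp add: birkhoff_average_def fun_eq_iff)
  ultimately show ?thesis
    by (simp only:) (intro continuous_intros)
qed

lemma birkhoff_average_uminus:
  "birkhoff_average f (\<lambda>x. - \<phi> x) n x = - birkhoff_average f \<phi> n x"
  by (simp add: birkhoff_average_def sum_negf)

lemma birkhoff_average_bound:
  assumes "\<forall>x. \<bar>\<phi> x\<bar> \<le> B"
  shows "\<bar>birkhoff_average f \<phi> n x\<bar> \<le> B"
proof (cases "n = 0")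
  case True
  have "0 \<le> B" using assms order_trans[OF abs_ge_zero] by blast
  with True show ?thesis by (simp add: birkhoff_average_def)
next
  case False
  have "\<bar>\<Sum>j<n. \<phi> ((f ^^ j) x)\<bar> \<le> (\<Sum>j<n. B)"
    by (rule order_trans[OF sum_abs sum_mono]) (use assms in blast)
  with False show ?thesis
    by (simp add: birkhoff_average_def abs_divide field_simps)
qed

text \<open>The two orbit segments differ only in their end points, so the difference of the averages
  is at most \<open>2 B / n\<close>.\<close>

lemma birkhoff_average_shift_tendsto_0:
  assumes B: "\<forall>x. \<bar>\<phi> x\<bar> \<le> B"
  shows "(\<lambda>n. birkhoff_average f \<phi> n (f x) - birkhoff_average f \<phi> n x) \<longlonglongrightarrow> 0"
proof (rule tendsto_0_le[where K = 1])
  have "(\<lambda>n. (2 * B) * (1 / real n)) \<longlonglongrightarrow> (2 * B) * 0"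
    by (intro tendsto_mult tendsto_const lim_1_over_n)
  then show "(\<lambda>n. 2 * B / real n) \<longlonglongrightarrow> 0" by simp
  show "eventually (\<lambda>n. norm (birkhoff_average f \<phi> n (f x) - birkhoff_average f \<phi> n x)
      \<le> norm (2 * B / real n) * 1) sequentially"
  proof (rule always_eventually, rule allI)
    fix n
    have "(\<Sum>j<n. \<phi> ((f ^^ j) (f x))) - (\<Sum>j<n. \<phi> ((f ^^ j) x)) = \<phi> ((f ^^ n) x) - \<phi> x"
      unfolding sum_subtractf[symmetric]
      using sum_lessThan_telescope[of "\<lambda>j. \<phi> ((f ^^ j) x)" n]
      by (simp add: funpow_swap1)
    then have "birkhoff_average f \<phi> n (f x) - birkhoff_average f \<phi> n x =
        (\<phi> ((f ^^ n) x) - \<phi> x) / real n"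
      by (simp add: birkhoff_average_def diff_divide_distrib[symmetric])
    moreover have "\<bar>\<phi> ((f ^^ n) x) - \<phi> x\<bar> \<le> \<bar>2 * B\<bar>"
      using spec[OF B, of x] spec[OF B, of "(f ^^ n) x"] by linarith
    ultimately show "norm (birkhoff_average f \<phi> n (f x) - birkhoff_average f \<phi> n x)
        \<le> norm (2 * B / real n) * 1"
      by (simp add: abs_divide divide_right_mono del: abs_mult)
  qed
qed

lemma birkhoff_average_orbit_tendsto_0:
  assumes B: "\<forall>x. \<bar>\<phi> x\<bar> \<le> B"
  shows "(\<lambda>n. birkhoff_average f \<phi> n ((f ^^ k) x) - birkhoff_average f \<phi> n x) \<longlonglongrightarrow> 0"
proof (induction k)
  case (Suc k)
  from tendsto_add[OF birkhoff_average_shift_tendsto_0[OF B, of f "(f ^^ k) x"] Suc]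
  show ?case by simp
qed simp

section \<open>Oscillating averages\<close>

text \<open>The averages at all points of the orbit of \<open>x\<close> exceed \<open>b\<close> infinitely often, because they are
  asymptotic to those at \<open>x\<close>, which exceed the larger number \<open>a\<close> infinitely often. So the set
  contains a dense orbit.\<close>

lemma dense_exceedance:
  fixes f :: "'a::metric_space \<Rightarrow> 'a"
  assumes "continuous_on UNIV f" "continuous_on UNIV \<phi>" and B: "\<forall>x. \<bar>\<phi> x\<bar> \<le> B"
    and dense: "closure (range (\<lambda>n. (f ^^ n) x)) = UNIV"
    and freq: "frequently (\<lambda>n. a < birkhoff_average f \<phi> n x) sequentially" and "b < a"
  shows "open {z. \<exists>n\<ge>N. b < birkhoff_average f \<phi> n z}"
    and "closure {z. \<exists>n\<ge>N. b < birkhoff_average f \<phi> n z} = UNIV"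
proof -
  have "{z. \<exists>n\<ge>N. b < birkhoff_average f \<phi> n z} = (\<Union>n\<in>{N..}. {z. b < birkhoff_average f \<phi> n z})"
    by auto
  also have "open \<dots>"
    by (intro open_UN ballI open_Collect_less continuous_on_const
        continuous_on_birkhoff_average assms)
  finally show "open {z. \<exists>n\<ge>N. b < birkhoff_average f \<phi> n z}" .
  have "(f ^^ k) x \<in> {z. \<exists>n\<ge>N. b < birkhoff_average f \<phi> n z}" for k
  proof -
    have "eventually (\<lambda>n. b - a < birkhoff_average f \<phi> n ((f ^^ k) x) - birkhoff_average f \<phi> n x)
        sequentially"
      by (rule order_tendstoD(1)[OF birkhoff_average_orbit_tendsto_0[OF B]]) (use \<open>b < a\<close> in simp)
    then have "eventually (\<lambda>n. N \<le> n \<and>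
        b - a < birkhoff_average f \<phi> n ((f ^^ k) x) - birkhoff_average f \<phi> n x) sequentially"
      by (intro eventually_conj eventually_ge_at_top)
    from frequently_eventually_frequently[OF freq this]
    obtain n where "a < birkhoff_average f \<phi> n x" "N \<le> n"
        "b - a < birkhoff_average f \<phi> n ((f ^^ k) x) - birkhoff_average f \<phi> n x"
      by (auto dest!: frequently_ex)
    then show ?thesis by (auto intro!: exI[of _ n])
  qed
  then have "range (\<lambda>n. (f ^^ n) x) \<subseteq> {z. \<exists>n\<ge>N. b < birkhoff_average f \<phi> n z}"
    by blast
  from closure_mono[OF this] dense
  show "closure {z. \<exists>n\<ge>N. b < birkhoff_average f \<phi> n z} = UNIV" by auto
qed

text \<open>Two thresholds \<open>t < s\<close> strictly between \<open>b\<close> and \<open>a\<close> leave room for the loss in the previous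
  lemma. It is applied to \<open>\<phi>\<close> with \<open>s < a\<close>, and to \<open>- \<phi>\<close> with \<open>- t < - b\<close>. In the intersection
  of the resulting dense open sets a limit would have to be at least \<open>s\<close> and at most \<open>t\<close>.\<close>

lemma residual_divergence:
  fixes f :: "'a::metric_space \<Rightarrow> 'a"
  assumes f: "continuous_on UNIV f" and \<phi>: "continuous_on UNIV \<phi>"
    and B: "\<forall>x. \<bar>\<phi> x\<bar> \<le> B"
    and dense: "\<And>x. closure (range (\<lambda>n. (f ^^ n) x)) = UNIV"
    and hi: "frequently (\<lambda>n. a < birkhoff_average f \<phi> n x) sequentially"
    and lo: "frequently (\<lambda>n. birkhoff_average f \<phi> n y < b) sequentially"
    and "b < a"
  shows "baire_residual {z. \<not> convergent (\<lambda>n. birkhoff_average f \<phi> n z)}"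
proof -
  define s t where "s = a - (a - b) / 3" and "t = b + (a - b) / 3"
  have st: "t < s" "s < a" "b < t" using \<open>b < a\<close> by (simp_all add: s_def t_def field_simps)
  define H where "H N = {z. \<exists>n\<ge>N. s < birkhoff_average f \<phi> n z}" for N
  define L where "L N = {z. \<exists>n\<ge>N. - t < birkhoff_average f (\<lambda>x. - \<phi> x) n z}" for N
  have \<phi>': "continuous_on UNIV (\<lambda>x. - \<phi> x)" "\<forall>x. \<bar>- \<phi> x\<bar> \<le> B"
    using \<phi> B by (auto intro: continuous_on_minus)
  have lo': "frequently (\<lambda>n. - b < birkhoff_average f (\<lambda>x. - \<phi> x) n y) sequentially"
    using lo by (simp add: birkhoff_average_uminus)
  have H: "open (H N)" "closure (H N) = UNIV" for N
    unfolding H_def using dense_exceedance[OF f \<phi> B dense hi st(2)] by blast+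
  have L: "open (L N)" "closure (L N) = UNIV" for N
    unfolding L_def using dense_exceedance[OF f \<phi>' dense lo', of "- t"] st(3) by simp_all
  have "\<Inter>(range H \<union> range L) \<subseteq> {z. \<not> convergent (\<lambda>n. birkhoff_average f \<phi> n z)}"
  proof
    fix z assume z: "z \<in> \<Inter>(range H \<union> range L)"
    show "z \<in> {z. \<not> convergent (\<lambda>n. birkhoff_average f \<phi> n z)}"
    proof (rule CollectI, rule notI)
      assume "convergent (\<lambda>n. birkhoff_average f \<phi> n z)"
      then obtain l where l: "(\<lambda>n. birkhoff_average f \<phi> n z) \<longlonglongrightarrow> l"
        by (auto simp: convergent_def)
      consider "l < s" | "t < l" using st by linarith
      then show False
      proof cases
        case 1
        then obtain N where "\<And>n. n \<ge> N \<Longrightarrow> birkhoff_average f \<phi> n z < s"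
          using order_tendstoD(2)[OF l] by (auto simp: eventually_sequentially)
        moreover have "z \<in> H N" using z by blast
        ultimately show False by (fastforce simp: H_def)
      next
        case 2
        then obtain N where "\<And>n. n \<ge> N \<Longrightarrow> t < birkhoff_average f \<phi> n z"
          using order_tendstoD(1)[OF l] by (auto simp: eventually_sequentially)
        moreover have "z \<in> L N" using z by blast
        ultimately show False by (fastforce simp: L_def birkhoff_average_uminus)
      qed
    qed
  qed
  with H L show ?thesis
    unfolding baire_residual_def by (intro exI[of _ "range H \<union> range L"]) auto
qed

text \<open>The hypothesis says that no upper limit of averages exceeds a lower limit, across all
  pairs of points. The bounded averages at one point have a cluster value \<open>l\<close>. It lies between
  the lower and the upper limit at that point, so at any other point the upper limit is at most
  \<open>l\<close> and the lower limit is at least \<open>l\<close>.\<close>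

lemma birkhoff_average_common_limit:
  assumes B: "\<forall>x. \<bar>\<phi> x\<bar> \<le> B"
    and ord: "\<And>x y a b. frequently (\<lambda>n. a < birkhoff_average f \<phi> n x) sequentially \<Longrightarrow>
      frequently (\<lambda>n. birkhoff_average f \<phi> n y < b) sequentially \<Longrightarrow> a \<le> b"
  shows "\<exists>l. \<forall>x. (\<lambda>n. birkhoff_average f \<phi> n x) \<longlonglongrightarrow> l"
proof -
  fix x0 :: 'a
  have "bounded (range (\<lambda>n. birkhoff_average f \<phi> n x0))"
    using birkhoff_average_bound[OF B] by (auto simp: bounded_iff)
  then obtain l r where r: "strict_mono r" "((\<lambda>n. birkhoff_average f \<phi> n x0) \<circ> r) \<longlonglongrightarrow> l"
    using bounded_imp_convergent_subsequence by blast
  have freq: "frequently (\<lambda>n. P (birkhoff_average f \<phi> n x0)) sequentially"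
    if ev: "eventually (\<lambda>n. P (((\<lambda>n. birkhoff_average f \<phi> n x0) \<circ> r) n)) sequentially" for P
  proof -
    obtain N where N: "\<And>n. n \<ge> N \<Longrightarrow> P (birkhoff_average f \<phi> (r n) x0)"
      using ev by (auto simp: eventually_sequentially)
    have "\<exists>n\<ge>m. P (birkhoff_average f \<phi> n x0)" for m
      using N[of "max m N"] seq_suble[OF r(1), of "max m N"]
      by (intro exI[of _ "r (max m N)"]) auto
    then show ?thesis by (simp add: frequently_sequentially)
  qed
  have "(\<lambda>n. birkhoff_average f \<phi> n x) \<longlonglongrightarrow> l" for x
  proof (rule order_tendstoI)
    fix a assume "a < l"
    then obtain d where d: "a < d" "d < l" using dense by blast
    have "frequently (\<lambda>n. d < birkhoff_average f \<phi> n x0) sequentially"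
      using order_tendstoD(1)[OF r(2) d(2)] by (rule freq)
    then have "\<not> frequently (\<lambda>n. birkhoff_average f \<phi> n x < (a + d) / 2) sequentially"
      using ord[of d x0 x "(a + d) / 2"] d by auto
    then have "eventually (\<lambda>n. \<not> birkhoff_average f \<phi> n x < (a + d) / 2) sequentially"
      by (simp add: frequently_def)
    then show "eventually (\<lambda>n. a < birkhoff_average f \<phi> n x) sequentially"
      by eventually_elim (use d in \<open>simp add: field_simps\<close>)
  next
    fix a assume "l < a"
    then obtain d where d: "l < d" "d < a" using dense by blast
    have "frequently (\<lambda>n. birkhoff_average f \<phi> n x0 < d) sequentially"
      using order_tendstoD(2)[OF r(2) d(1)] by (rule freq)
    then have "\<not> frequently (\<lambda>n. (a + d) / 2 < birkhoff_average f \<phi> n x) sequentially"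
      using ord[of "(a + d) / 2" x x0 d] d by auto
    then have "eventually (\<lambda>n. \<not> (a + d) / 2 < birkhoff_average f \<phi> n x) sequentially"
      by (simp add: frequently_def)
    then show "eventually (\<lambda>n. birkhoff_average f \<phi> n x < a) sequentially"
      by eventually_elim (use d in \<open>simp add: field_simps\<close>)
  qed
  then show ?thesis by blast
qed

section \<open>Weak* limits of empirical measures\<close>

text \<open>The empirical measure is the image of the uniform distribution on \<open>{..<n}\<close> under
  \<open>j \<mapsto> f\<^sup>j x\<close>.\<close>

lemma integral_empirical_measure:
  fixes \<phi> :: "'a::topological_space \<Rightarrow> real"
  assumes "\<phi> \<in> borel_measurable borel" "n > 0"
  shows "integral\<^sup>L (empirical_measure f n x) \<phi> = birkhoff_average f \<phi> n x"
proof -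
  let ?U = "uniform_count_measure {..<n}"
  have meas: "(\<lambda>j. (f ^^ j) x) \<in> measurable ?U borel"
    by (simp add: uniform_count_measure_def point_measure_def)
  have "empirical_measure f n x = distr ?U borel (\<lambda>j. (f ^^ j) x)"
  proof (rule measure_eqI)
    fix A assume "A \<in> sets (empirical_measure f n x)"
    then have A: "A \<in> sets borel" by simp
    have "(\<Sum>j<n. indicator A ((f ^^ j) x) :: ennreal) = of_nat (card ((\<lambda>j. (f ^^ j) x) -` A \<inter> {..<n}))"
      by (simp add: indicator_def of_bool_def sum.If_cases Int_commute vimage_def Collect_conj_eq)
    then show "emeasure (empirical_measure f n x) A = emeasure (distr ?U borel (\<lambda>j. (f ^^ j) x)) A"
      using A meas \<open>n > 0\<close>
      by (simp add: emeasure_empirical_measure emeasure_distr emeasure_uniform_count_measure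
          space_uniform_count_measure ennreal_of_nat_eq_real_of_nat flip: ennreal_mult)
  qed simp
  then show ?thesis
    using assms meas
    by (simp add: integral_distr integral_uniform_count_measure birkhoff_average_def)
qed

lemma irregular_if_divergent_average:
  assumes \<phi>: "continuous_on UNIV \<phi>" and div: "\<not> convergent (\<lambda>n. birkhoff_average f \<phi> n x)"
  shows "x \<in> irregular_set f"
  unfolding irregular_set_def
proof (rule CollectI, rule notI)
  assume "\<exists>\<nu>. limitin weak_star_topology (\<lambda>n. empirical_measure f n x) \<nu> sequentially"
  then obtain l where "(\<lambda>n. integral\<^sup>L (empirical_measure f n x) \<phi>) \<longlonglongrightarrow> l"
    using \<phi> by (auto simp: limitin_weak_star)
  moreover have "eventually (\<lambda>n. integral\<^sup>L (empirical_measure f n x) \<phi> = birkhoff_average f \<phi> n x)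
      sequentially"
    using eventually_gt_at_top[of 0]
    by eventually_elim (simp add: integral_empirical_measure borel_measurable_continuous_onI \<phi>)
  ultimately have "(\<lambda>n. birkhoff_average f \<phi> n x) \<longlonglongrightarrow> l"
    by (simp cong: tendsto_cong)
  with div show False by (auto simp: convergent_def)
qed

lemma empirical_measure_limit:
  assumes "\<mu> \<in> borel_prob"
    and lim: "\<And>\<phi>. continuous_on UNIV \<phi> \<Longrightarrow> (\<lambda>n. birkhoff_average f \<phi> n x) \<longlonglongrightarrow> integral\<^sup>L \<mu> \<phi>"
  shows "limitin weak_star_topology (\<lambda>n. empirical_measure f n x) \<mu> sequentially"
  unfolding limitin_weak_star
proof (intro conjI allI impI)
  show "eventually (\<lambda>n. empirical_measure f n x \<in> borel_prob) sequentially"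
    using eventually_gt_at_top[of 0] by eventually_elim (rule empirical_measure_in_borel_prob)
  fix \<phi> :: "'a \<Rightarrow> real" assume \<phi>: "continuous_on UNIV \<phi>"
  have "eventually (\<lambda>n. birkhoff_average f \<phi> n x = integral\<^sup>L (empirical_measure f n x) \<phi>)
      sequentially"
    using eventually_gt_at_top[of 0]
    by eventually_elim (simp add: integral_empirical_measure borel_measurable_continuous_onI \<phi>)
  then show "(\<lambda>n. integral\<^sup>L (empirical_measure f n x) \<phi>) \<longlonglongrightarrow> integral\<^sup>L \<mu> \<phi>"
    by (rule Lim_transform_eventually[OF lim[OF \<phi>]])
qed fact

section \<open>Invariance and ergodicity of a common limit of averages\<close>

locale uniquely_averaging =
  fixes f :: "'a::metric_space \<Rightarrow> 'a" and \<mu> :: "'a measure"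
  assumes compact_space: "compact (UNIV :: 'a set)"
    and continuous: "continuous_on UNIV f"
    and prob: "\<mu> \<in> borel_prob"
    and average_tendsto: "\<And>\<phi> x. continuous_on UNIV \<phi> \<Longrightarrow>
      (\<lambda>n. birkhoff_average f \<phi> n x) \<longlonglongrightarrow> integral\<^sup>L \<mu> \<phi>"
begin

sublocale prob_space \<mu>
  using prob by (simp add: borel_prob_def)

lemma sets_eq [measurable_cong, simp]: "sets \<mu> = sets borel"
  using prob by (simp add: borel_prob_def)

lemma space_eq [simp]: "space \<mu> = UNIV"
  using sets_eq_imp_space_eq[OF sets_eq] by simp

lemma measurable_f [measurable]: "f \<in> measurable borel borel"
  by (rule borel_measurable_continuous_onI[OF continuous])

lemma integrable_continuous: "continuous_on UNIV \<phi> \<Longrightarrow> integrable \<mu> (\<phi> :: 'a \<Rightarrow> real)"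
  by (rule integrable_continuous_compact) (simp_all add: compact_space finite_measure_axioms)

text \<open>The averages of \<open>\<phi> \<circ> f\<close> at \<open>x\<close> are those of \<open>\<phi>\<close> at \<open>f x\<close>, so both functions have the same
  limit of averages, that is, the same integral.\<close>

lemma integral_compose_f:
  fixes \<phi> :: "'a \<Rightarrow> real"
  assumes \<phi>: "continuous_on UNIV \<phi>"
  shows "integral\<^sup>L \<mu> (\<lambda>x. \<phi> (f x)) = integral\<^sup>L \<mu> \<phi>"
proof -
  obtain B where B: "\<forall>x. \<bar>\<phi> x\<bar> \<le> B"
    using bounded_continuous_compact[OF compact_space \<phi>] by blast
  have "birkhoff_average f (\<lambda>x. \<phi> (f x)) n x = birkhoff_average f \<phi> n (f x)" for n x
    by (simp add: birkhoff_average_def funpow_swap1)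
  moreover have "continuous_on UNIV (\<lambda>x. \<phi> (f x))"
    by (rule continuous_on_compose2[OF \<phi> continuous]) simp
  ultimately have "(\<lambda>n. birkhoff_average f \<phi> n (f x)) \<longlonglongrightarrow> integral\<^sup>L \<mu> (\<lambda>x. \<phi> (f x))" for x
    using average_tendsto[of "\<lambda>x. \<phi> (f x)" x] by simp
  with average_tendsto[OF \<phi>] show ?thesis by (blast intro: LIMSEQ_unique)
qed

lemma distr_f: "distr \<mu> borel f = \<mu>"
proof (rule finite_measure_eqI_continuous)
  show "finite_measure (distr \<mu> borel f)"
    by (rule finite_measure_distr) measurable
  show "integral\<^sup>L (distr \<mu> borel f) \<phi> = integral\<^sup>L \<mu> \<phi>" if "continuous_on UNIV \<phi>" for \<phi> :: "'a \<Rightarrow> real"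
    using borel_measurable_continuous_onI[OF that]
    by (simp add: integral_distr integral_compose_f that)
qed (simp_all add: finite_measure_axioms)

lemma invariant: "invariant_measure f \<mu>"
  unfolding invariant_measure_def
proof
  fix A :: "'a set" assume "A \<in> sets borel"
  then have "emeasure (distr \<mu> borel f) A = emeasure \<mu> (f -` A)"
    by (subst emeasure_distr) auto
  then show "emeasure \<mu> (f -` A) = emeasure \<mu> A" by (simp add: distr_f)
qed

lemma integral_indicator_compose_f:
  fixes \<phi> :: "'a \<Rightarrow> real"
  assumes "continuous_on UNIV \<phi>" "A \<in> sets borel" "f -` A = A"
  shows "(\<integral>x. indicator A x * \<phi> (f x) \<partial>\<mu>) = (\<integral>x. indicator A x * \<phi> x \<partial>\<mu>)"
proof -
  have [measurable]: "\<phi> \<in> borel_measurable borel"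
    by (rule borel_measurable_continuous_onI) fact
  have "indicator A (f x) = (indicator A x :: real)" for x
    using assms(3) by (auto simp: indicator_def)
  then have "(\<integral>x. indicator A x * \<phi> (f x) \<partial>\<mu>) = (\<integral>x. indicator A (f x) * \<phi> (f x) \<partial>\<mu>)"
    by simp
  also have "\<dots> = (\<integral>x. indicator A x * \<phi> x \<partial>distr \<mu> borel f)"
    using assms(2) by (subst integral_distr) auto
  finally show ?thesis by (simp add: distr_f)
qed

text \<open>As \<open>\<mu>\<close> and \<open>A\<close> are invariant, integrating over \<open>A\<close> any Birkhoff average of \<open>\<phi>\<close> gives the same
  value as integrating \<open>\<phi>\<close> itself. On the other hand the averages converge boundedly to the
  constant \<open>\<integral> \<phi> d\<mu>\<close>.\<close>

lemma integral_indicator_invariant: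
  assumes \<phi>: "continuous_on UNIV \<phi>" and A: "A \<in> sets borel" "f -` A = A"
  shows "(\<integral>x. indicator A x * \<phi> x \<partial>\<mu>) = measure \<mu> A * integral\<^sup>L \<mu> \<phi>"
proof -
  obtain B where B: "\<forall>x. \<bar>\<phi> x\<bar> \<le> B"
    using bounded_continuous_compact[OF compact_space \<phi>] by blast
  have cont_j: "continuous_on UNIV (\<lambda>x. \<phi> ((f ^^ j) x))" for j
    by (rule continuous_on_compose2[OF \<phi> continuous_on_funpow[OF continuous]]) simp
  have inv_j: "(\<integral>x. indicator A x * \<phi> ((f ^^ j) x) \<partial>\<mu>) = (\<integral>x. indicator A x * \<phi> x \<partial>\<mu>)" for j
  proof (induction j)
    case (Suc j)
    then show ?case
      using integral_indicator_compose_f[OF cont_j[of j] A] by (simp add: funpow_swap1)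
  qed simp
  have int_j: "integrable \<mu> (\<lambda>x. indicator A x * \<phi> ((f ^^ j) x))" for j
    using integrable_real_mult_indicator[OF _ integrable_continuous[OF cont_j[of j]], of A] A
    by (simp add: mult.commute)
  have avg: "(\<integral>x. indicator A x * birkhoff_average f \<phi> n x \<partial>\<mu>) = (\<integral>x. indicator A x * \<phi> x \<partial>\<mu>)"
    if "n > 0" for n
  proof -
    have "(\<integral>x. indicator A x * birkhoff_average f \<phi> n x \<partial>\<mu>) =
        (\<integral>x. (\<Sum>j<n. indicator A x * \<phi> ((f ^^ j) x)) / real n \<partial>\<mu>)"
      by (simp add: birkhoff_average_def sum_distrib_left)
    also have "\<dots> = (\<Sum>j<n. \<integral>x. indicator A x * \<phi> ((f ^^ j) x) \<partial>\<mu>) / real n"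
      by (simp only: integral_divide_zero Bochner_Integration.integral_sum int_j)
    finally show ?thesis using that by (simp add: inv_j)
  qed
  have "(\<lambda>n. \<integral>x. indicator A x * birkhoff_average f \<phi> n x \<partial>\<mu>)
      \<longlonglongrightarrow> (\<integral>x. indicator A x * integral\<^sup>L \<mu> \<phi> \<partial>\<mu>)"
  proof (rule integral_dominated_convergence[where w = "\<lambda>_. B"])
    have [measurable]: "birkhoff_average f \<phi> n \<in> borel_measurable borel" for n
      by (intro borel_measurable_continuous_onI continuous_on_birkhoff_average continuous \<phi>)
    show "(\<lambda>x. indicator A x * birkhoff_average f \<phi> n x) \<in> borel_measurable \<mu>" for n
      using A by measurable
    show "(\<lambda>x. indicator A x * integral\<^sup>L \<mu> \<phi>) \<in> borel_measurable \<mu>"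
      using A by measurable
    show "AE x in \<mu>. (\<lambda>n. indicator A x * birkhoff_average f \<phi> n x)
        \<longlonglongrightarrow> indicator A x * integral\<^sup>L \<mu> \<phi>"
      by (intro AE_I2 tendsto_mult tendsto_const average_tendsto \<phi>)
    show "AE x in \<mu>. norm (indicator A x * birkhoff_average f \<phi> n x) \<le> B" for n
      using birkhoff_average_bound[OF B, of f n] order_trans[OF abs_ge_zero spec[OF B]]
      by (auto simp: indicator_def)
  qed simp
  moreover have "eventually (\<lambda>n. (\<integral>x. indicator A x * birkhoff_average f \<phi> n x \<partial>\<mu>) =
      (\<integral>x. indicator A x * \<phi> x \<partial>\<mu>)) sequentially"
    using eventually_gt_at_top[of 0] by eventually_elim (rule avg)
  ultimately have "(\<lambda>n. \<integral>x. indicator A x * \<phi> x \<partial>\<mu>) \<longlonglongrightarrow> (\<integral>x. indicator A x * integral\<^sup>L \<mu> \<phi> \<partial>\<mu>)"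
    by (rule Lim_transform_eventually)
  then have "(\<integral>x. indicator A x * \<phi> x \<partial>\<mu>) = (\<integral>x. indicator A x * integral\<^sup>L \<mu> \<phi> \<partial>\<mu>)"
    by (simp add: LIMSEQ_const_iff)
  then show ?thesis using A by simp
qed

text \<open>By the previous lemma the restriction \<open>\<nu>\<close> of \<open>\<mu>\<close> to \<open>A\<close> and the multiple \<open>\<mu>'\<close> of \<open>\<mu>\<close> by the
  factor \<open>\<mu> A\<close> have the same integrals of continuous functions, so they are equal.
  Their values at \<open>A\<close> are \<open>\<mu> A\<close> and \<open>(\<mu> A)\<^sup>2\<close>.\<close>

lemma ergodic: "ergodic_measure f \<mu>"
  unfolding ergodic_measure_def
proof (intro conjI ballI impI invariant)
  fix A assume A: "A \<in> sets borel" "f -` A = A"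
  define \<nu> where "\<nu> = density \<mu> (\<lambda>x. ennreal (indicator A x))"
  define \<mu>' where "\<mu>' = density \<mu> (\<lambda>_. ennreal (measure \<mu> A))"
  have \<nu>_eq: "emeasure \<nu> X = emeasure \<mu> (A \<inter> X)" if "X \<in> sets borel" for X
    using that A
    by (simp add: \<nu>_def emeasure_density ennreal_indicator flip: indicator_inter_arith)
  have \<mu>'_eq: "emeasure \<mu>' X = emeasure \<mu> A * emeasure \<mu> X" if "X \<in> sets borel" for X
    using that by (simp add: \<mu>'_def emeasure_density_const emeasure_eq_measure)
  have "\<nu> = \<mu>'"
  proof (rule finite_measure_eqI_continuous)
    have "space \<nu> = UNIV" "space \<mu>' = UNIV"
      by (simp_all add: \<nu>_def \<mu>'_def)
    then show "finite_measure \<nu>" "finite_measure \<mu>'"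
      by (auto intro!: finite_measureI
          simp: \<nu>_eq \<mu>'_eq emeasure_eq_measure ennreal_mult_eq_top_iff)
    fix \<phi> :: "'a \<Rightarrow> real" assume \<phi>: "continuous_on UNIV \<phi>"
    then have meas: "\<phi> \<in> borel_measurable \<mu>"
      using borel_measurable_continuous_onI[OF \<phi>] by simp
    have "integral\<^sup>L \<nu> \<phi> = (\<integral>x. indicator A x * \<phi> x \<partial>\<mu>)"
      unfolding \<nu>_def using A meas by (subst integral_density) auto
    also have "\<dots> = measure \<mu> A * integral\<^sup>L \<mu> \<phi>"
      by (rule integral_indicator_invariant[OF \<phi> A])
    also have "\<dots> = integral\<^sup>L \<mu>' \<phi>"
      unfolding \<mu>'_def using meas by (subst integral_density) auto
    finally show "integral\<^sup>L \<nu> \<phi> = integral\<^sup>L \<mu>' \<phi>" .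
  qed (simp_all add: \<nu>_def \<mu>'_def)
  then have "emeasure \<mu> A = emeasure \<mu> A * emeasure \<mu> A"
    using \<nu>_eq[OF A(1)] \<mu>'_eq[OF A(1)] by simp
  then have "measure \<mu> A = measure \<mu> A * measure \<mu> A"
    by (simp add: emeasure_eq_measure flip: ennreal_mult)
  then have "measure \<mu> A = 0 \<or> measure \<mu> A = 1" by simp
  then show "emeasure \<mu> A = 0 \<or> emeasure \<mu> A = 1" by (auto simp: emeasure_eq_measure)
qed

end

section \<open>The dichotomy for minimal maps\<close>

lemma limit_functional:
  fixes f :: "'a::metric_space \<Rightarrow> 'a"
  assumes "compact (UNIV :: 'a set)"
    and lim: "\<And>\<phi> x. continuous_on UNIV \<phi> \<Longrightarrow> (\<lambda>n. birkhoff_average f \<phi> n x) \<longlonglongrightarrow> c \<phi>"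
  shows "positive_normalized_functional c"
proof
  show "compact (UNIV :: 'a set)" by fact
  fix \<phi> \<psi> :: "'a \<Rightarrow> real" and r :: real
  fix x :: 'a
  assume \<phi>: "continuous_on UNIV \<phi>"
  have "(\<lambda>n. birkhoff_average f (\<lambda>x. r * \<phi> x) n x) = (\<lambda>n. r * birkhoff_average f \<phi> n x)"
    by (simp add: birkhoff_average_def sum_distrib_left[symmetric])
  then show "c (\<lambda>x. r * \<phi> x) = r * c \<phi>"
    using lim[of "\<lambda>x. r * \<phi> x" x] tendsto_mult[OF tendsto_const[of r] lim[OF \<phi>, of x]]
      continuous_on_mult_left[OF \<phi>]
    by (simp add: LIMSEQ_unique)
  assume \<psi>: "continuous_on UNIV \<psi>"
  have "(\<lambda>n. birkhoff_average f (\<lambda>x. \<phi> x + \<psi> x) n x) =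
      (\<lambda>n. birkhoff_average f \<phi> n x + birkhoff_average f \<psi> n x)"
    by (simp add: birkhoff_average_def sum.distrib add_divide_distrib)
  then show "c (\<lambda>x. \<phi> x + \<psi> x) = c \<phi> + c \<psi>"
    using lim[of "\<lambda>x. \<phi> x + \<psi> x" x] tendsto_add[OF lim[OF \<phi>, of x] lim[OF \<psi>, of x]]
      continuous_on_add[OF \<phi> \<psi>]
    by (simp add: LIMSEQ_unique)
  assume "\<And>x. \<phi> x \<le> \<psi> x"
  then have "birkhoff_average f \<phi> n x \<le> birkhoff_average f \<psi> n x" for n
    by (auto simp: birkhoff_average_def intro!: divide_right_mono sum_mono)
  then show "c \<phi> \<le> c \<psi>"
    using lim[OF \<phi>, of x] lim[OF \<psi>, of x] by (auto intro: LIMSEQ_le)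
next
  fix x :: 'a
  have "eventually (\<lambda>n. 1 = birkhoff_average f (\<lambda>_. 1) n x) sequentially"
    using eventually_gt_at_top[of 0] by eventually_elim (simp add: birkhoff_average_def)
  then have "(\<lambda>n. birkhoff_average f (\<lambda>_. 1) n x) \<longlonglongrightarrow> 1"
    by (rule Lim_transform_eventually[OF tendsto_const])
  then show "c (\<lambda>_. 1) = 1"
    using lim[of "\<lambda>_. 1" x] by (auto intro: LIMSEQ_unique)
qed

theorem corollary4:
  fixes f :: "'a::metric_space \<Rightarrow> 'a"
  assumes "compact (UNIV :: 'a set)"
    and "continuous_on UNIV f"
    and "minimal_map f"
  shows "(\<exists>\<mu> \<in> borel_prob. invariant_measure f \<mu> \<and> ergodic_measure f \<mu> \<and>
            (\<forall>x. limitin weak_star_topology (\<lambda>n. empirical_measure f n x) \<mu> sequentially))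
         \<or> baire_residual (irregular_set f)"
proof (cases "\<exists>\<phi> :: 'a \<Rightarrow> real. \<exists>a b x y. continuous_on UNIV \<phi> \<and> b < a \<and>
    frequently (\<lambda>n. a < birkhoff_average f \<phi> n x) sequentially \<and>
    frequently (\<lambda>n. birkhoff_average f \<phi> n y < b) sequentially")
  case True
  then obtain \<phi> :: "'a \<Rightarrow> real" and a b x y where \<phi>: "continuous_on UNIV \<phi>" and "b < a"
    "frequently (\<lambda>n. a < birkhoff_average f \<phi> n x) sequentially"
    "frequently (\<lambda>n. birkhoff_average f \<phi> n y < b) sequentially"
    by blast
  moreover obtain B where "\<forall>x. \<bar>\<phi> x\<bar> \<le> B"
    using bounded_continuous_compact[OF assms(1) \<phi>] by blast
  ultimately have "baire_residual {z. \<not> convergent (\<lambda>n. birkhoff_average f \<phi> n z)}"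
    using assms(2,3) by (intro residual_divergence) (auto simp: minimal_map_def)
  moreover have "{z. \<not> convergent (\<lambda>n. birkhoff_average f \<phi> n z)} \<subseteq> irregular_set f"
    using irregular_if_divergent_average[OF \<phi>] by blast
  ultimately have "baire_residual (irregular_set f)"
    unfolding baire_residual_def by (meson subset_trans)
  then show ?thesis ..
next
  case False
  have "\<exists>l. \<forall>x. (\<lambda>n. birkhoff_average f \<phi> n x) \<longlonglongrightarrow> l" if \<phi>: "continuous_on UNIV \<phi>" for \<phi>
  proof -
    obtain B where B: "\<forall>x. \<bar>\<phi> x\<bar> \<le> B"
      using bounded_continuous_compact[OF assms(1) \<phi>] by blast
    show ?thesis
      by (rule birkhoff_average_common_limit[OF B]) (use False \<phi> not_le in blast)
  qed
  then obtain c where c: "\<And>\<phi> x. continuous_on UNIV \<phi> \<Longrightarrow>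
      (\<lambda>n. birkhoff_average f \<phi> n x) \<longlonglongrightarrow> c \<phi>"
    by metis
  interpret positive_normalized_functional c
    by (rule limit_functional[OF assms(1) c])
  have lim: "(\<lambda>n. birkhoff_average f \<phi> n x) \<longlonglongrightarrow> integral\<^sup>L representing_measure \<phi>"
    if "continuous_on UNIV \<phi>" for \<phi> x
    using c that by (simp add: integral_representing_measure)
  interpret uniquely_averaging f representing_measure
    by unfold_locales (use assms lim representing_measure_in_borel_prob in auto)
  have "limitin weak_star_topology (\<lambda>n. empirical_measure f n x) representing_measure sequentially"
    for x
    by (rule empirical_measure_limit[OF representing_measure_in_borel_prob lim])
  then show ?thesis
    using invariant ergodic representing_measure_in_borel_prob by blast
qed

end
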